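(* Let $j,k,p$ be non-negative integers with $1 \le p \le k-j$. A graph $G$ is a cograph minimal $(\infty,k)$-polar obstruction of type $(k-j+2,p)$ if and only if $G \cong K_2 + G'$, where $G'$ is a cograph minimal $(\infty,k-1)$-polar obstruction of type $(k-j+1,p)$ which is a $(1,k)$-polar graph.
   Context: All graphs are finite and simple. A cograph is a graph with no induced subgraph isomorphic to $P_4$. $G+H$ denotes disjoint union. A component is trivial if it is isomorphic to $K_1$. A cluster is a disjoint union of complete graphs. For $s,k \in \mathbb{Z}_{\ge 0}\cup\{\infty\}$, an $(s,k)$-polar partition of $G$ is a partition $(A,B)$ of $V(G)$ (parts may be empty) such that $G[A]$ is a complete multipartite graph with at most $s$ parts and $G[B]$ is a cluster with at most $k$ components; $\infty$ means unbounded. $G$ is $(s,k)$-polar if it has such a partition. A cograph minimal $(s,k)$-polar obstruction is a cograph that is not $(s,k)$-polar but all of whose proper induced subgraphs are $(s,k)$-polar. Such an obstruction has type $(c,i)$ if it has exactly $c$ connected components, exactly $i$ of which are trivial. *)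

theory Defs
  imports Main "HOL-Library.Extended_Nat" "HOL-Library.Disjoint_Sets"
begin

record 'a graph =
  verts :: "'a set"
  adj :: "'a \<Rightarrow> 'a \<Rightarrow> bool"

definition simple_graph :: "'a graph \<Rightarrow> bool" where
  "simple_graph G \<longleftrightarrow>
     finite (verts G) \<and>
     (\<forall>u v. adj G u v \<longrightarrow> u \<in> verts G \<and> v \<in> verts G) \<and>
     (\<forall>u v. adj G u v \<longrightarrow> adj G v u) \<and>
     (\<forall>v. \<not> adj G v v)"

definition induced :: "'a graph \<Rightarrow> 'a set \<Rightarrow> 'a graph" where
  "induced G S =
     \<lparr>verts = verts G \<inter> S,
      adj = (\<lambda>u v. u \<in> verts G \<inter> S \<and> v \<in> verts G \<inter> S \<and> adj G u v)\<rparr>"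

definition graph_iso :: "'a graph \<Rightarrow> 'b graph \<Rightarrow> bool" where
  "graph_iso G H \<longleftrightarrow>
     (\<exists>f. bij_betw f (verts G) (verts H) \<and>
          (\<forall>u\<in>verts G. \<forall>v\<in>verts G. adj G u v \<longleftrightarrow> adj H (f u) (f v)))"

definition disjoint_union :: "'a graph \<Rightarrow> 'b graph \<Rightarrow> ('a + 'b) graph" where
  "disjoint_union G H =
     \<lparr>verts = verts G <+> verts H,
      adj = (\<lambda>x y. case (x, y) of
                (Inl u, Inl v) \<Rightarrow> adj G u v
              | (Inr u, Inr v) \<Rightarrow> adj H u v
              | _ \<Rightarrow> False)\<rparr>"

definition complete_graph :: "nat \<Rightarrow> nat graph" where
  "complete_graph n =
     \<lparr>verts = {..<n}, adj = (\<lambda>u v. u < n \<and> v < n \<and> u \<noteq> v)\<rparr>"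

definition path_graph :: "nat \<Rightarrow> nat graph" where
  "path_graph n =
     \<lparr>verts = {..<n}, adj = (\<lambda>u v. u < n \<and> v < n \<and> (v = Suc u \<or> u = Suc v))\<rparr>"

definition cograph :: "'a graph \<Rightarrow> bool" where
  "cograph G \<longleftrightarrow>
     simple_graph G \<and>
     \<not> (\<exists>S \<subseteq> verts G. graph_iso (induced G S) (path_graph 4))"

text \<open>Connected components are represented by their vertex sets.\<close>

definition components :: "'a graph \<Rightarrow> 'a set set" where
  "components G = {{u \<in> verts G. (adj G)\<^sup>*\<^sup>* v u} | v. v \<in> verts G}"

definition trivial_components :: "'a graph \<Rightarrow> 'a set set" where
  "trivial_components G =
     {C \<in> components G. graph_iso (induced G C) (complete_graph 1)}"

definition complete :: "'a graph \<Rightarrow> bool" where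
  "complete G \<longleftrightarrow> (\<forall>u\<in>verts G. \<forall>v\<in>verts G. u \<noteq> v \<longrightarrow> adj G u v)"

definition cluster :: "'a graph \<Rightarrow> bool" where
  "cluster G \<longleftrightarrow> (\<forall>C\<in>components G. complete (induced G C))"

text \<open>The parts of a complete multipartite graph are non-empty (as the blocks of
  a \<^const>\<open>partition_on\<close>), so the graph without vertices has no parts
  and an edgeless graph with at least one vertex has one part.\<close>

definition complete_multipartite_parts :: "'a graph \<Rightarrow> 'a set set \<Rightarrow> bool" where
  "complete_multipartite_parts G P \<longleftrightarrow>
     partition_on (verts G) P \<and>
     (\<forall>u\<in>verts G. \<forall>v\<in>verts G. adj G u v \<longleftrightarrow> \<not> (\<exists>X\<in>P. u \<in> X \<and> v \<in> X))"

definition polar_partition :: "enat \<Rightarrow> enat \<Rightarrow> 'a graph \<Rightarrow> 'a set \<Rightarrow> 'a set \<Rightarrow> bool" where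
  "polar_partition s k G A B \<longleftrightarrow>
     A \<union> B = verts G \<and> A \<inter> B = {} \<and>
     (\<exists>P. complete_multipartite_parts (induced G A) P \<and> enat (card P) \<le> s) \<and>
     cluster (induced G B) \<and> enat (card (components (induced G B))) \<le> k"

definition polar :: "enat \<Rightarrow> enat \<Rightarrow> 'a graph \<Rightarrow> bool" where
  "polar s k G \<longleftrightarrow> (\<exists>A B. polar_partition s k G A B)"

definition cograph_min_polar_obstruction :: "enat \<Rightarrow> enat \<Rightarrow> 'a graph \<Rightarrow> bool" where
  "cograph_min_polar_obstruction s k G \<longleftrightarrow>
     cograph G \<and> \<not> polar s k G \<and> (\<forall>S. S \<subset> verts G \<longrightarrow> polar s k (induced G S))"

definition has_type :: "'a graph \<Rightarrow> nat \<Rightarrow> nat \<Rightarrow> bool" where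
  "has_type G c i \<longleftrightarrow> card (components G) = c \<and> card (trivial_components G) = i"

end

theory Submission
  imports Defs
begin

text \<open>A complete multipartite graph is either edgeless or connected, so in a polar partition
  \<open>(A, B)\<close> of a disconnected graph the part \<open>A\<close> is independent or lies inside one component.
  Consequently, for a component \<open>K \<cong> K\<^sub>2\<close> of \<open>G\<close>, the graph \<open>G\<close> is \<open>(\<infinity>, k)\<close>-polar iff
  \<open>G - K\<close> is \<open>(\<infinity>, k - 1)\<close>-polar, and deleting one end of \<open>K\<close> from a minimal obstruction shows
  that \<open>G - K\<close> is \<open>(1, k)\<close>-polar. Such a \<open>K\<close> exists: deleting an isolated vertex from a minimal
  obstruction leaves a partition with \<open>A\<close> not independent, so some nontrivial component misses
  \<open>A\<close> and is complete; a complete component with three or more vertices is impossible, since a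
  partition of the graph with one of its vertices deleted could be extended.\<close>

subsection \<open>Polar partitions of vertex sets\<close>

definition independent_set :: "'a graph \<Rightarrow> 'a set \<Rightarrow> bool" where
  "independent_set G I \<longleftrightarrow> (\<forall>u\<in>I. \<forall>v\<in>I. \<not> adj G u v)"

definition clique :: "'a graph \<Rightarrow> 'a set \<Rightarrow> bool" where
  "clique G K \<longleftrightarrow> (\<forall>u\<in>K. \<forall>v\<in>K. u \<noteq> v \<longrightarrow> adj G u v)"

text \<open>Transitivity of non-adjacency. In a simple graph this makes non-adjacency an equivalence
  relation on \<open>A\<close>, whose classes are the parts of a complete multipartite
  graph.\<close>

definition multipartite_on :: "'a graph \<Rightarrow> 'a set \<Rightarrow> bool" where
  "multipartite_on G A \<longleftrightarrow>
     (\<forall>u\<in>A. \<forall>v\<in>A. \<forall>w\<in>A. \<not> adj G u v \<longrightarrow> \<not> adj G v w \<longrightarrow> \<not> adj G u w)"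

text \<open>In a cluster, the number of components is the largest size of an independent set; this
  bounds it without mentioning components.\<close>

definition cluster_on :: "'a graph \<Rightarrow> nat \<Rightarrow> 'a set \<Rightarrow> bool" where
  "cluster_on G k B \<longleftrightarrow>
     (\<forall>u\<in>B. \<forall>v\<in>B. \<forall>w\<in>B. adj G u v \<longrightarrow> adj G v w \<longrightarrow> u \<noteq> w \<longrightarrow> adj G u w) \<and>
     (\<forall>I\<subseteq>B. independent_set G I \<longrightarrow> card I \<le> k)"

text \<open>Polarity with unboundedly many parts, for the subgraph induced by \<open>S\<close>. It
  is read off the adjacency of the ambient graph, so that deleting or adding vertices changes only a
  set.\<close>

definition polar_on :: "'a graph \<Rightarrow> nat \<Rightarrow> 'a set \<Rightarrow> bool" where
  "polar_on G k S \<longleftrightarrow> (\<exists>A\<subseteq>S. multipartite_on G A \<and> cluster_on G k (S - A))"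

text \<open>The case of at most one part, where complete multipartite means edgeless.\<close>

definition unipolar_on :: "'a graph \<Rightarrow> nat \<Rightarrow> 'a set \<Rightarrow> bool" where
  "unipolar_on G k S \<longleftrightarrow> (\<exists>A\<subseteq>S. independent_set G A \<and> cluster_on G k (S - A))"

definition min_obstruction_on :: "'a graph \<Rightarrow> nat \<Rightarrow> 'a set \<Rightarrow> bool" where
  "min_obstruction_on G k S \<longleftrightarrow> \<not> polar_on G k S \<and> (\<forall>T. T \<subset> S \<longrightarrow> polar_on G k T)"

text \<open>For a simple graph, the subsets of \<open>verts G\<close> with this property are the
  unions of connected components. It replaces components in the combinatorial arguments, which then
  avoid reachability.\<close>

definition adj_closed :: "'a graph \<Rightarrow> 'a set \<Rightarrow> bool" where
  "adj_closed G K \<longleftrightarrow> (\<forall>u\<in>K. \<forall>v. adj G u v \<longrightarrow> v \<in> K)"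

lemma simple_graphD:
  assumes "simple_graph G"
  shows "finite (verts G)" "adj G u v \<Longrightarrow> u \<in> verts G" "adj G u v \<Longrightarrow> v \<in> verts G"
    "adj G u v \<Longrightarrow> adj G v u" "\<not> adj G v v"
  using assms by (simp_all add: simple_graph_def)

lemma adj_closedD: "adj_closed G K \<Longrightarrow> u \<in> K \<Longrightarrow> adj G u v \<Longrightarrow> v \<in> K"
  by (auto simp: adj_closed_def)

lemma independent_imp_multipartite: "independent_set G A \<Longrightarrow> multipartite_on G A"
  by (auto simp: independent_set_def multipartite_on_def)

lemma clique_imp_multipartite:
  "simple_graph G \<Longrightarrow> clique G A \<Longrightarrow> multipartite_on G A"
  unfolding clique_def multipartite_on_def by (metis simple_graphD(5))

lemma multipartite_on_subset: "multipartite_on G A \<Longrightarrow> A' \<subseteq> A \<Longrightarrow> multipartite_on G A'"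
  by (auto simp: multipartite_on_def)

lemma cluster_on_subset: "cluster_on G k B \<Longrightarrow> B' \<subseteq> B \<Longrightarrow> cluster_on G k B'"
  unfolding cluster_on_def by (meson subset_iff subset_trans)

lemma min_obstruction_onD: "min_obstruction_on G k S \<Longrightarrow> T \<subset> S \<Longrightarrow> polar_on G k T"
  by (simp add: min_obstruction_on_def)

lemma polar_on_subset:
  assumes "polar_on G k S" "T \<subseteq> S"
  shows "polar_on G k T"
proof -
  obtain A where A: "A \<subseteq> S" "multipartite_on G A" "cluster_on G k (S - A)"
    using assms(1) by (auto simp: polar_on_def)
  have "multipartite_on G (A \<inter> T)"
    by (rule multipartite_on_subset[OF A(2)]) simp
  moreover have "cluster_on G k (T - A \<inter> T)"
    by (rule cluster_on_subset[OF A(3)]) (use assms(2) in blast)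
  ultimately show ?thesis unfolding polar_on_def by (metis inf_le2)
qed

lemma unipolar_imp_polar: "unipolar_on G k S \<Longrightarrow> polar_on G k S"
  unfolding unipolar_on_def polar_on_def by (blast intro: independent_imp_multipartite)

text \<open>A multipartite set with an edge is connected: \<open>u\<close> is adjacent to an end
  \<open>c\<close> of that edge, and every other vertex of \<open>A\<close> is adjacent to
  \<open>u\<close> or to \<open>c\<close>. So all of \<open>A\<close> is within distance two of
  \<open>u\<close>.\<close>

lemma multipartite_within_closed:
  assumes G: "simple_graph G" and A: "multipartite_on G A" "\<not> independent_set G A"
    and K: "adj_closed G K" and u: "u \<in> A" "u \<in> K"
  shows "A \<subseteq> K"
proof
  fix v assume v: "v \<in> A"
  obtain a b where ab: "a \<in> A" "b \<in> A" "adj G a b"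
    using A(2) by (auto simp: independent_set_def)
  have tr: "\<And>u v w. u \<in> A \<Longrightarrow> v \<in> A \<Longrightarrow> w \<in> A \<Longrightarrow> adj G u w \<Longrightarrow> adj G u v \<or> adj G v w"
    using A(1) unfolding multipartite_on_def by blast
  obtain c where c: "c \<in> A" "adj G u c"
    using tr[OF ab(1) u(1) ab(2) ab(3)] ab by (auto dest: simple_graphD(4)[OF G])
  have "adj G u v \<or> adj G c v"
    using tr[OF u(1) v c(1) c(2)] by (auto dest: simple_graphD(4)[OF G])
  then show "v \<in> K"
    using adj_closedD[OF K u(2)] adj_closedD[OF K adj_closedD[OF K u(2) c(2)]] by blast
qed

section \<open>Adding and removing vertices of clusters\<close>

text \<open>Every independent subset of \<open>B'\<close> becomes a larger independent subset of
  \<open>B\<close> when \<open>x\<close> is added, so the bound drops by one.\<close>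

lemma cluster_on_remove:
  assumes G: "simple_graph G" and B: "cluster_on G (Suc k) B" "B' \<subseteq> B" "B \<subseteq> verts G"
    and x: "x \<in> B" "x \<notin> B'" "\<And>v. v \<in> B' \<Longrightarrow> \<not> adj G x v"
  shows "cluster_on G k B'"
proof -
  have "card I \<le> k" if I: "I \<subseteq> B'" "independent_set G I" for I
  proof -
    have "independent_set G (insert x I)"
      using I x(3) simple_graphD(4)[OF G, of _ x] simple_graphD(5)[OF G]
      unfolding independent_set_def by blast
    moreover have "insert x I \<subseteq> B" using I(1) x(1) B(2) by blast
    ultimately have "card (insert x I) \<le> Suc k" using B(1) by (auto simp: cluster_on_def)
    moreover have "finite I" "x \<notin> I"
      using I(1) x(2) B(2,3) simple_graphD(1)[OF G] by (auto intro: finite_subset)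
    ultimately show ?thesis by simp
  qed
  then show ?thesis
    using cluster_on_subset[OF B(1,2)] unfolding cluster_on_def by blast
qed

text \<open>An independent set meets the clique \<open>C\<close> in at most one vertex, so the bound
  grows by at most one.\<close>

lemma cluster_on_add:
  assumes G: "simple_graph G" and B: "cluster_on G k B" "B \<subseteq> verts G"
    and C: "clique G C" "C \<subseteq> verts G" "\<And>u v. u \<in> B \<Longrightarrow> v \<in> C \<Longrightarrow> \<not> adj G u v"
  shows "cluster_on G (Suc k) (B \<union> C)"
  unfolding cluster_on_def
proof (intro conjI ballI allI impI)
  fix u v w assume uvw: "u \<in> B \<union> C" "v \<in> B \<union> C" "w \<in> B \<union> C" "adj G u v" "adj G v w" "u \<noteq> w"
  then consider "u \<in> B" "v \<in> B" "w \<in> B" | "u \<in> C" "v \<in> C" "w \<in> C"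
    using C(3) simple_graphD(4)[OF G] by blast
  then show "adj G u w"
    using uvw B(1) C(1) unfolding cluster_on_def clique_def by cases blast+
next
  fix I assume I: "I \<subseteq> B \<union> C" "independent_set G I"
  have fin: "finite I" "finite (I \<inter> C)"
    using I(1) B(2) C(2) simple_graphD(1)[OF G] by (auto intro: finite_subset)
  have "is_singleton (I \<inter> C) \<or> I \<inter> C = {}"
    using I(2) C(1) unfolding independent_set_def clique_def is_singleton_def by blast
  then have "card (I \<inter> C) \<le> 1"
    by (auto simp: is_singleton_def)
  moreover have "card (I - C) \<le> k"
    using B(1) I unfolding cluster_on_def independent_set_def by (metis DiffD1 Diff_subset_conv Un_commute)
  moreover have "card I = card (I \<inter> C) + card (I - C)"
    using card_Int_Diff[OF fin(1)] .
  ultimately show "card I \<le> Suc k" by simp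
qed

text \<open>The vertex \<open>w\<close> joins the clique of \<open>w'\<close>, which is already
  present, so no new component arises and the bound stays.\<close>

lemma cluster_on_extend:
  assumes G: "simple_graph G" and B: "cluster_on G k B" "B \<subseteq> verts G"
    and K: "clique G K" "adj_closed G K" and w: "w' \<in> B" "w' \<in> K" "w \<in> K"
  shows "cluster_on G k (insert w B)"
proof (cases "w \<in> B")
  case True
  then show ?thesis using B(1) by (simp add: insert_absorb)
next
  case False
  note sym = simple_graphD(4)[OF G]
  note irr = simple_graphD(5)[OF G]
  have nb: "adj G z u \<longleftrightarrow> u \<in> K \<and> u \<noteq> z" if "z \<in> K" for u z
    using K that irr[of z] unfolding clique_def adj_closed_def by metis
  show ?thesis
    unfolding cluster_on_def
  proof (intro conjI ballI allI impI)
    fix a b c assume abc: "a \<in> insert w B" "b \<in> insert w B" "c \<in> insert w B"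
      "adj G a b" "adj G b c" "a \<noteq> c"
    show "adj G a c"
    \<comment> \<open>The path \<open>a\<close>, \<open>b\<close>, \<open>c\<close> lies either
      inside the closed set \<open>K\<close> or outside it. In the latter case it avoids
      \<open>w\<close> and stays in \<open>B\<close>.\<close>
    proof (cases "a \<in> K \<or> b \<in> K \<or> c \<in> K")
      case True
      then have "a \<in> K" "c \<in> K"
        using adj_closedD[OF K(2)] abc(4,5) sym[OF abc(4)] sym[OF abc(5)] by metis+
      then show ?thesis using K(1) abc(6) by (auto simp: clique_def)
    next
      case False
      then show ?thesis using abc w(3) B(1) unfolding cluster_on_def by blast
    qed
  next
    fix I assume I: "I \<subseteq> insert w B" "independent_set G I"
    show "card I \<le> k"
    proof (cases "w \<in> I")
      case True
      have fin: "finite I"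
        using I(1) B(2) simple_graphD(1)[OF G] by (meson finite_insert finite_subset)
      have IK: "I \<inter> K = {w}"
        using I(2) True nb[OF w(3)] w(3) unfolding independent_set_def by blast
      \<comment> \<open>Exchange \<open>w\<close> for \<open>w'\<close>: all neighbours of
        \<open>w'\<close> lie in \<open>K\<close>, which \<open>I\<close> meets only in
        \<open>w\<close>. The result has the size of \<open>I\<close> and lies in
        \<open>B\<close>.\<close>
      let ?J = "insert w' (I - {w})"
      have "independent_set G ?J"
        using I(2) IK nb[OF w(2)] irr sym[of _ w'] unfolding independent_set_def by blast
      moreover have "?J \<subseteq> B" using I(1) w(1) by blast
      ultimately have "card ?J \<le> k" using B(1) by (auto simp: cluster_on_def)
      moreover have "w' \<notin> I - {w}" using IK w(2) by blast
      ultimately show ?thesis using fin card.remove[OF fin True] by simp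
    next
      case False
      then show ?thesis using I B(1) unfolding cluster_on_def by blast
    qed
  qed
qed

text \<open>One clique of the cluster can serve as the multipartite side, with singleton parts; this
  relies on the number of parts being unbounded.\<close>

lemma cluster_imp_polar_on:
  assumes G: "simple_graph G" and S: "S \<subseteq> verts G" and c: "cluster_on G (Suc k) S"
  shows "polar_on G k S"
proof (cases "S = {}")
  case True
  then show ?thesis
    by (auto simp: polar_on_def multipartite_on_def cluster_on_def)
next
  case False
  then obtain x where x: "x \<in> S" by blast
  \<comment> \<open>The closed neighbourhood of \<open>x\<close> within \<open>S\<close>, which in a
    cluster is the whole component of \<open>x\<close>.\<close>
  let ?A = "{v \<in> S. v = x \<or> adj G x v}"
  have "clique G ?A"
    unfolding clique_def
  proof (intro ballI impI)
    fix u v assume uv: "u \<in> ?A" "v \<in> ?A" "u \<noteq> v"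
    show "adj G u v"
    proof (cases "u = x")
      case False
      then have "adj G u x" using uv simple_graphD(4)[OF G] by blast
      then show ?thesis using c x uv unfolding cluster_on_def by blast
    qed (use uv in blast)
  qed
  then have "multipartite_on G ?A" by (rule clique_imp_multipartite[OF G])
  moreover have "cluster_on G k (S - ?A)"
    by (rule cluster_on_remove[OF G c _ S x]) (use x in auto)
  moreover have "?A \<subseteq> S" by blast
  ultimately show ?thesis unfolding polar_on_def by metis
qed

section \<open>Isolated edges, that is, connected components isomorphic to
  \<open>K_2\<close>\<close>

definition isolated_edge :: "'a graph \<Rightarrow> 'a \<Rightarrow> 'a \<Rightarrow> bool" where
  "isolated_edge G x y \<longleftrightarrow> x \<noteq> y \<and> clique G {x, y} \<and> adj_closed G {x, y}"

lemma isolated_edgeD: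
  assumes "simple_graph G" "isolated_edge G x y"
  shows "x \<noteq> y" "adj G x y" "x \<in> verts G" "y \<in> verts G"
    "adj G x u \<longleftrightarrow> u = y" "adj G y u \<longleftrightarrow> u = x" "adj G u x \<longleftrightarrow> u = y" "adj G u y \<longleftrightarrow> u = x"
proof -
  show xy: "x \<noteq> y" "adj G x y" using assms by (auto simp: isolated_edge_def clique_def)
  then show "x \<in> verts G" "y \<in> verts G" using simple_graphD[OF assms(1)] by blast+
  have yx: "adj G y x" using xy simple_graphD[OF assms(1)] by blast
  show 1: "adj G x u \<longleftrightarrow> u = y" "adj G y u \<longleftrightarrow> u = x" for u
    using assms xy yx simple_graphD(5)[OF assms(1)]
    unfolding isolated_edge_def adj_closed_def by blast+
  show "adj G u x \<longleftrightarrow> u = y" "adj G u y \<longleftrightarrow> u = x"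
    using 1 simple_graphD(4)[OF assms(1)] by blast+
qed

text \<open>The edge can always be placed as a further component of the cluster side. Conversely, if
  some end is on the cluster side, it occupies a component of its own there; if both ends are in
  \<open>A\<close>, then \<open>A\<close> contains nothing else and \<open>S\<close> is a
  cluster.\<close>

lemma polar_on_add_edge:
  assumes G: "simple_graph G" and e: "isolated_edge G x y"
    and S: "S \<subseteq> verts G" "x \<notin> S" "y \<notin> S"
  shows "polar_on G (Suc k) (insert x (insert y S)) \<longleftrightarrow> polar_on G k S"
proof
  note E = isolated_edgeD[OF G e]
  assume "polar_on G k S"
  then obtain A where A: "A \<subseteq> S" "multipartite_on G A" "cluster_on G k (S - A)"
    by (auto simp: polar_on_def)
  have "cluster_on G (Suc k) ((S - A) \<union> {x, y})"
    by (rule cluster_on_add[OF G A(3)])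
       (use e E S in \<open>auto simp: isolated_edge_def\<close>)
  moreover have "(S - A) \<union> {x, y} = insert x (insert y S) - A" using A(1) S by blast
  ultimately show "polar_on G (Suc k) (insert x (insert y S))"
    using A unfolding polar_on_def by auto
next
  note E = isolated_edgeD[OF G e]
  let ?S = "insert x (insert y S)"
  assume "polar_on G (Suc k) ?S"
  then obtain A where A: "A \<subseteq> ?S" "multipartite_on G A" "cluster_on G (Suc k) (?S - A)"
    by (auto simp: polar_on_def)
  have SV: "?S - A \<subseteq> verts G" using S E by blast
  show "polar_on G k S"
  proof (cases "{x, y} \<subseteq> A")
    case True
    then have "\<not> independent_set G A" using E(2) by (auto simp: independent_set_def)
    then have "A \<subseteq> {x, y}"
      using multipartite_within_closed[OF G A(2)] True e by (auto simp: isolated_edge_def)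
    \<comment> \<open>All of \<open>S\<close> is a cluster with bound \<open>Suc k\<close>; moving
      one of its cliques to the multipartite side restores the bound \<open>k\<close>.\<close>
    then have "S \<subseteq> ?S - A" using S by blast
    then show ?thesis using cluster_imp_polar_on[OF G S(1)] cluster_on_subset[OF A(3)] by blast
  next
    case False
    \<comment> \<open>The only neighbour of \<open>z\<close> is the other end of the edge, which is
      outside \<open>S\<close>.\<close>
    then obtain z where z: "z \<in> {x, y}" "z \<notin> A" by blast
    have "cluster_on G k (S - A)"
      by (rule cluster_on_remove[OF G A(3) _ SV, of _ z]) (use z S E in auto)
    moreover have "S - A = S - (A \<inter> S)" by blast
    moreover have "multipartite_on G (A \<inter> S)" using multipartite_on_subset[OF A(2)] by blast
    ultimately show ?thesis unfolding polar_on_def by (metis inf_le2)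
  qed
qed

text \<open>Subsets containing both ends are handled by \<open>polar_on_add_edge\<close>. The other
  proper subsets lie in \<open>insert x S\<close> or \<open>insert y S\<close>, and when
  \<open>verts G\<close> is not polar, polarity of these two sets amounts to unipolarity of
  \<open>S\<close>.\<close>

lemma min_obstruction_add_edge:
  assumes G: "simple_graph G" and e: "isolated_edge G x y"
  defines "S \<equiv> verts G - {x, y}"
  shows "min_obstruction_on G (Suc k) (verts G) \<longleftrightarrow>
    min_obstruction_on G k S \<and> unipolar_on G (Suc k) S"
proof
  note E = isolated_edgeD[OF G e]
  have V: "verts G = insert x (insert y S)" and S: "S \<subseteq> verts G" "x \<notin> S" "y \<notin> S"
    using E by (auto simp: S_def)
  note add = polar_on_add_edge[OF G e, where k = k]
  {
    assume m: "min_obstruction_on G (Suc k) (verts G)"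
    have "polar_on G k T" if T: "T \<subset> S" for T
    proof -
      obtain t where "t \<in> S" "t \<notin> T" using T by blast
      then have "t \<in> verts G" "t \<notin> insert x (insert y T)" using S by blast+
      moreover have "insert x (insert y T) \<subseteq> verts G" using T V by blast
      ultimately have "insert x (insert y T) \<subset> verts G" by blast
      then have "polar_on G (Suc k) (insert x (insert y T))"
        by (rule min_obstruction_onD[OF m])
      then show ?thesis using add[of T] T S by blast
    qed
    moreover have "\<not> polar_on G k S"
      using m add[OF S] V by (simp add: min_obstruction_on_def)
    moreover have "unipolar_on G (Suc k) S"
    proof -
      \<comment> \<open>Only \<open>x\<close> is deleted, which leaves \<open>y\<close> without
        neighbours.\<close>
      have "insert y S \<subset> verts G" using V S E(1) by blast
      then have "polar_on G (Suc k) (insert y S)"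
        by (rule min_obstruction_onD[OF m])
      then obtain A where A: "A \<subseteq> insert y S" "multipartite_on G A"
        "cluster_on G (Suc k) (insert y S - A)"
        by (auto simp: polar_on_def)
      show ?thesis
      proof (cases "independent_set G A")
        case True
        then have "independent_set G (A \<inter> S)" by (auto simp: independent_set_def)
        moreover have "cluster_on G (Suc k) (S - A \<inter> S)"
          by (rule cluster_on_subset[OF A(3)]) blast
        ultimately show ?thesis unfolding unipolar_on_def by (metis inf_le2)
      next
        case False
        have "y \<notin> A"
        proof
          assume "y \<in> A"
          then have "A \<subseteq> {x, y}"
            using multipartite_within_closed[OF G A(2) False] e by (auto simp: isolated_edge_def)
          then have "A \<subseteq> {y}" using A(1) S E(1) by blast
          then show False using False simple_graphD(5)[OF G] by (auto simp: independent_set_def)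
        qed
        \<comment> \<open>Since \<open>y\<close> is on the cluster side, \<open>x\<close> can be put
          back next to it. This would make \<open>verts G\<close> polar, so \<open>A\<close> cannot
          contain an edge.\<close>
        then have "cluster_on G (Suc k) (insert x (insert y S - A))"
          using cluster_on_extend[OF G A(3), of "{x, y}" y x] e S E
          by (auto simp: isolated_edge_def)
        moreover have "insert x (insert y S - A) = verts G - A" using V A(1) S E(1) by blast
        ultimately have "polar_on G (Suc k) (verts G)"
          using A(1,2) V unfolding polar_on_def by auto
        then show ?thesis using m by (simp add: min_obstruction_on_def)
      qed
    qed
    ultimately show "min_obstruction_on G k S \<and> unipolar_on G (Suc k) S"
      by (simp add: min_obstruction_on_def)
  next
    assume m: "min_obstruction_on G k S \<and> unipolar_on G (Suc k) S"
    obtain A where A: "A \<subseteq> S" "independent_set G A" "cluster_on G (Suc k) (S - A)"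
      using m by (auto simp: unipolar_on_def)
    \<comment> \<open>The only neighbour of \<open>z\<close> is outside \<open>insert z S\<close>,
      so \<open>z\<close> can join the independent side.\<close>
    have one: "polar_on G (Suc k) (insert z S)" if z: "z \<in> {x, y}" for z
    proof -
      have "independent_set G (insert z A)"
        using A(1,2) z S E simple_graphD(5)[OF G] unfolding independent_set_def by auto
      moreover have "insert z S - insert z A = S - A" using z S by blast
      ultimately have "unipolar_on G (Suc k) (insert z S)"
        using A(1,3) unfolding unipolar_on_def by (metis insert_mono)
      then show ?thesis by (rule unipolar_imp_polar)
    qed
    have "polar_on G (Suc k) T" if T: "T \<subset> verts G" for T
    proof (cases "{x, y} \<subseteq> T")
      case True
      let ?T = "T - {x, y}"
      have "?T \<subset> S" using True T V by blast
      then have "polar_on G k ?T" using m min_obstruction_onD by blast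
      moreover have "insert x (insert y ?T) = T" using True by blast
      moreover have "?T \<subseteq> verts G" using T by blast
      ultimately show ?thesis using add[of ?T] by simp
    next
      case False
      have "T \<subseteq> insert x (insert y S)" using T V by simp
      then consider "T \<subseteq> insert y S" | "T \<subseteq> insert x S" using False by blast
      then show ?thesis
        using polar_on_subset[OF one[of x]] polar_on_subset[OF one[of y]] by cases simp_all
    qed
    moreover have "\<not> polar_on G (Suc k) (verts G)"
      using m add[OF S] V by (simp add: min_obstruction_on_def)
    ultimately show "min_obstruction_on G (Suc k) (verts G)"
      by (simp add: min_obstruction_on_def)
  }
qed

section \<open>Complete components and isolated vertices of minimal obstructions\<close>

text \<open>Delete a vertex \<open>w\<close> of \<open>K\<close> and repair the resulting partition:
  \<open>w\<close> returns either to a vertex of \<open>K\<close> on the cluster side or, if there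
  is none, to a multipartite side enlarged to all of \<open>K\<close>.\<close>

lemma min_obstruction_clique_component_le_2:
  assumes G: "simple_graph G" and m: "min_obstruction_on G k (verts G)"
    and K: "K \<subseteq> verts G" "clique G K" "adj_closed G K"
  shows "card K \<le> 2"
proof (rule ccontr)
  assume c: "\<not> card K \<le> 2"
  then obtain w where w: "w \<in> K" by fastforce
  let ?S = "verts G - {w}"
  have "?S \<subset> verts G" using w K(1) by blast
  then have "polar_on G k ?S" by (rule min_obstruction_onD[OF m])
  then obtain A where A: "A \<subseteq> ?S" "multipartite_on G A" "cluster_on G k (?S - A)"
    unfolding polar_on_def by blast
  have np: "\<not> polar_on G k (verts G)" using m by (simp add: min_obstruction_on_def)
  show False
  proof (cases "\<exists>w'. w' \<in> ?S - A \<and> w' \<in> K")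
    case True
    then obtain w' where w': "w' \<in> ?S - A" "w' \<in> K" by blast
    have "cluster_on G k (insert w (?S - A))"
      using cluster_on_extend[OF G A(3) _ K(2,3) w' w] by blast
    moreover have "insert w (?S - A) = verts G - A" using w K(1) A(1) by blast
    ultimately show False using np A(1,2) unfolding polar_on_def by auto
  next
    case False
    then have KA: "K - {w} \<subseteq> A" using K(1) by blast
    \<comment> \<open>Here at least three vertices are needed: the remaining ones put an edge into
      \<open>A\<close>, which confines \<open>A\<close> to \<open>K\<close>.\<close>
    have "card (K - {w}) \<ge> 2" using c w by simp
    then obtain a b where ab: "a \<in> K - {w}" "b \<in> K - {w}" "a \<noteq> b"
      by (metis card_le_Suc0_iff_eq card.infinite not_less_eq_eq numeral_2_eq_2 zero_le)
    then have "\<not> independent_set G A"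
      using KA K(2) unfolding independent_set_def clique_def by blast
    then have "A \<subseteq> K"
      using multipartite_within_closed[OF G A(2) _ K(3)] ab KA by blast
    then have "cluster_on G k (verts G - K)"
      using w by (intro cluster_on_subset[OF A(3)]) blast
    then show False
      using np K(1) clique_imp_multipartite[OF G K(2)] unfolding polar_on_def by blast
  qed
qed

text \<open>Deleting the isolated vertex forces a polar partition whose multipartite part is connected,
  so it misses one of the two closed sets, which then lies in the cluster part.\<close>

lemma min_obstruction_isolated_vertex_cluster:
  assumes G: "simple_graph G" and m: "min_obstruction_on G k (verts G)"
    and v: "v \<in> verts G" "adj_closed G {v}"
    and K: "adj_closed G K" "adj_closed G L" "K \<inter> L = {}" "K \<subseteq> verts G" "L \<subseteq> verts G"
      "v \<notin> K" "v \<notin> L"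
  shows "cluster_on G k K \<or> cluster_on G k L"
proof -
  let ?S = "verts G - {v}"
  have "?S \<subset> verts G" using v by blast
  then have "polar_on G k ?S" by (rule min_obstruction_onD[OF m])
  then obtain A where A: "A \<subseteq> ?S" "multipartite_on G A" "cluster_on G k (?S - A)"
    unfolding polar_on_def by blast
  \<comment> \<open>Otherwise the isolated vertex \<open>v\<close> could be added to
    \<open>A\<close>, and the whole graph would be polar.\<close>
  have "\<not> independent_set G A"
  proof
    assume "independent_set G A"
    then have "independent_set G (insert v A)"
      using v(2) simple_graphD(5)[OF G]
      by (auto simp: independent_set_def adj_closed_def dest: simple_graphD(4)[OF G])
    moreover have "verts G - insert v A = ?S - A" by blast
    ultimately have "unipolar_on G k (verts G)"
      using A(1,3) v(1) unfolding unipolar_on_def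
      by (metis Diff_subset insert_subset subset_trans)
    then show False using m unipolar_imp_polar by (auto simp: min_obstruction_on_def)
  qed
  then have "A \<inter> K = {} \<or> A \<inter> L = {}"
    using multipartite_within_closed[OF G A(2)] K by blast
  then have "K \<subseteq> ?S - A \<or> L \<subseteq> ?S - A" using K by blast
  then show ?thesis using cluster_on_subset[OF A(3)] by blast
qed


subsection \<open>Induced subgraphs and polarity\<close>

lemma verts_induced [simp]: "verts (induced G S) = verts G \<inter> S"
  by (simp add: induced_def)

lemma adj_induced [simp]:
  "adj (induced G S) u v \<longleftrightarrow> u \<in> verts G \<inter> S \<and> v \<in> verts G \<inter> S \<and> adj G u v"
  by (simp add: induced_def)

lemma induced_induced [simp]: "induced (induced G S) T = induced G (S \<inter> T)"
  by (auto simp: induced_def fun_eq_iff)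

lemma induced_verts: "simple_graph G \<Longrightarrow> induced G (verts G) = G"
  by (cases G) (auto simp: induced_def simple_graph_def fun_eq_iff)

lemma simple_graph_induced: "simple_graph G \<Longrightarrow> simple_graph (induced G S)"
  by (auto simp: simple_graph_def)

section \<open>Connected components and reachability\<close>

definition component_of :: "'a graph \<Rightarrow> 'a \<Rightarrow> 'a set" where
  "component_of G v = {u \<in> verts G. (adj G)\<^sup>*\<^sup>* v u}"

lemma components_eq: "components G = component_of G ` verts G"
  by (auto simp: components_def component_of_def)

lemma reachable_sym:
  assumes "simple_graph G" "(adj G)\<^sup>*\<^sup>* u v"
  shows "(adj G)\<^sup>*\<^sup>* v u"
  using assms(2)
proof induction
  case (step v w)
  then have "adj G w v" using simple_graphD(4)[OF assms(1)] by blast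
  then show ?case using step by (meson converse_rtranclp_into_rtranclp)
qed simp

lemma component_of_eq_iff:
  assumes "simple_graph G" "u \<in> verts G" "v \<in> verts G"
  shows "component_of G u = component_of G v \<longleftrightarrow> (adj G)\<^sup>*\<^sup>* u v"
proof
  assume "component_of G u = component_of G v"
  moreover have "v \<in> component_of G v" using assms(3) by (simp add: component_of_def)
  ultimately show "(adj G)\<^sup>*\<^sup>* u v" by (auto simp: component_of_def)
next
  assume "(adj G)\<^sup>*\<^sup>* u v"
  then show "component_of G u = component_of G v"
    using reachable_sym[OF assms(1)] unfolding component_of_def by (auto intro: rtranclp_trans)
qed

section \<open>Agreement of the set-based notions with polar partitions\<close>

text \<open>In a cluster an independent set contains at most one vertex of each component, and a
  choice of one vertex per component is independent.\<close>

lemma cluster_iff_cluster_on: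
  assumes G: "simple_graph G"
  shows "cluster G \<and> card (components G) \<le> k \<longleftrightarrow> cluster_on G k (verts G)"
proof
  assume c: "cluster G \<and> card (components G) \<le> k"
  have ad: "adj G u v"
    if "u \<in> verts G" "v \<in> verts G" "(adj G)\<^sup>*\<^sup>* u v" "u \<noteq> v" for u v
  proof -
    have "component_of G u \<in> components G" using that(1) by (simp add: components_eq)
    then have "complete (induced G (component_of G u))" using c by (simp add: cluster_def)
    then show ?thesis using that by (simp add: complete_def component_of_def)
  qed
  show "cluster_on G k (verts G)"
    unfolding cluster_on_def
  proof (intro conjI ballI allI impI)
    fix u v w assume "u \<in> verts G" "w \<in> verts G" "adj G u v" "adj G v w" "u \<noteq> w"
    then show "adj G u w" by (intro ad) auto
  next
    fix I assume I: "I \<subseteq> verts G" "independent_set G I"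
    have "inj_on (component_of G) I"
    proof (rule inj_onI, rule ccontr)
      fix u v assume uv: "u \<in> I" "v \<in> I" "component_of G u = component_of G v" "u \<noteq> v"
      then have "adj G u v"
        using I(1) component_of_eq_iff[OF G, of u v] by (intro ad) auto
      then show False using I(2) uv by (auto simp: independent_set_def)
    qed
    then have "card I = card (component_of G ` I)" by (simp add: card_image)
    also have "\<dots> \<le> card (components G)"
      using I(1) simple_graphD(1)[OF G] by (intro card_mono) (auto simp: components_eq)
    finally show "card I \<le> k" using c by simp
  qed
next
  assume c: "cluster_on G k (verts G)"
  \<comment> \<open>Transitivity of adjacency shortens every walk to at most one edge.\<close>
  have reach: "u = v \<or> adj G u v" if "(adj G)\<^sup>*\<^sup>* u v" for u v
    using that
  proof induction
    case (step v w)
    then have "u \<in> verts G" "v \<in> verts G" "w \<in> verts G"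
      using simple_graphD(2,3)[OF G] by blast+
    then show ?case using step c unfolding cluster_on_def by blast
  qed simp
  have "adj G u v"
    if C: "C \<in> components G" "u \<in> C" "v \<in> C" "u \<noteq> v" for C u v
  proof -
    obtain z where "(adj G)\<^sup>*\<^sup>* z u" "(adj G)\<^sup>*\<^sup>* z v"
      using C by (auto simp: components_eq component_of_def)
    then have "(adj G)\<^sup>*\<^sup>* u v" using reachable_sym[OF G] by (meson rtranclp_trans)
    then show ?thesis using reach C(4) by blast
  qed
  then have "cluster G" by (auto simp: cluster_def complete_def)
  moreover have "card (components G) \<le> k"
  proof -
    \<comment> \<open>A system of representatives, one from each component.\<close>
    obtain I where I: "I \<subseteq> verts G" "inj_on (component_of G) I" "components G = component_of G ` I"
      using subset_image_inj[of "components G" "component_of G" "verts G"]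
      by (auto simp: components_eq)
    have "independent_set G I"
      unfolding independent_set_def
    proof (intro ballI notI)
      fix u v assume uv: "u \<in> I" "v \<in> I" "adj G u v"
      then have "component_of G u = component_of G v"
        using I(1) component_of_eq_iff[OF G, of u v] by auto
      then have "u = v" using I(2) uv by (auto dest: inj_onD)
      then show False using uv simple_graphD(5)[OF G] by blast
    qed
    then have "card I \<le> k" using c I(1) by (auto simp: cluster_on_def)
    then show ?thesis using I by (simp add: card_image)
  qed
  ultimately show "cluster G \<and> card (components G) \<le> k" by simp
qed

text \<open>The parts are the classes of the non-adjacency relation \<open>r\<close>, where
  simplicity supplies reflexivity and symmetry.\<close>

lemma complete_multipartite_iff_multipartite_on:
  assumes G: "simple_graph G"
  shows "(\<exists>P. complete_multipartite_parts G P) \<longleftrightarrow> multipartite_on G (verts G)"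
proof
  assume "\<exists>P. complete_multipartite_parts G P"
  then obtain P where P: "partition_on (verts G) P"
    "\<And>u v. u \<in> verts G \<Longrightarrow> v \<in> verts G \<Longrightarrow> adj G u v \<longleftrightarrow> \<not> (\<exists>X\<in>P. u \<in> X \<and> v \<in> X)"
    by (auto simp: complete_multipartite_parts_def)
  show "multipartite_on G (verts G)"
    unfolding multipartite_on_def
  proof (intro ballI impI)
    fix u v w assume uvw: "u \<in> verts G" "v \<in> verts G" "w \<in> verts G" "\<not> adj G u v" "\<not> adj G v w"
    obtain X Y where XY: "X \<in> P" "Y \<in> P" "u \<in> X" "v \<in> X" "v \<in> Y" "w \<in> Y"
      using P(2)[of u v] P(2)[of v w] uvw by blast
    then have "X = Y" using P(1) unfolding partition_on_def disjoint_def by blast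
    then show "\<not> adj G u w" using P(2)[of u w] uvw XY by blast
  qed
next
  assume m: "multipartite_on G (verts G)"
  define r where "r = {(u, v). u \<in> verts G \<and> v \<in> verts G \<and> \<not> adj G u v}"
  have eq: "equiv (verts G) r"
  proof (rule equivI)
    show "r \<subseteq> verts G \<times> verts G" by (auto simp: r_def)
    show "refl_on (verts G) r" using simple_graphD(5)[OF G] by (auto simp: r_def refl_on_def)
    show "sym r" using simple_graphD(4)[OF G] by (auto simp: r_def sym_def)
    show "trans r" using m unfolding r_def trans_def multipartite_on_def by blast
  qed
  have "adj G u v \<longleftrightarrow> \<not> (\<exists>X\<in>verts G // r. u \<in> X \<and> v \<in> X)"
    if uv: "u \<in> verts G" "v \<in> verts G" for u v
  proof -
    have "(u, v) \<in> r \<longleftrightarrow> (\<exists>X\<in>verts G // r. u \<in> X \<and> v \<in> X)"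
    proof
      assume "(u, v) \<in> r"
      then show "\<exists>X\<in>verts G // r. u \<in> X \<and> v \<in> X"
        using equiv_class_self[OF eq uv(1)] by (intro bexI[OF _ quotientI[OF uv(1)]]) auto
    next
      assume "\<exists>X\<in>verts G // r. u \<in> X \<and> v \<in> X"
      then show "(u, v) \<in> r" using in_quotient_imp_in_rel[OF eq] by auto
    qed
    moreover have "(u, v) \<in> r \<longleftrightarrow> \<not> adj G u v" using uv by (simp add: r_def)
    ultimately show ?thesis by blast
  qed
  then have "complete_multipartite_parts G (verts G // r)"
    using partition_on_quotient[OF eq] by (simp add: complete_multipartite_parts_def)
  then show "\<exists>P. complete_multipartite_parts G P" by blast
qed

lemma complete_1_partite_iff_independent:
  assumes G: "simple_graph G"
  shows "(\<exists>P. complete_multipartite_parts G P \<and> enat (card P) \<le> 1) \<longleftrightarrow>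
    independent_set G (verts G)"
proof
  assume "\<exists>P. complete_multipartite_parts G P \<and> enat (card P) \<le> 1"
  then obtain P where P: "partition_on (verts G) P" "card P \<le> Suc 0"
    "\<And>u v. u \<in> verts G \<Longrightarrow> v \<in> verts G \<Longrightarrow> adj G u v \<longleftrightarrow> \<not> (\<exists>X\<in>P. u \<in> X \<and> v \<in> X)"
    by (auto simp: complete_multipartite_parts_def one_enat_def)
  \<comment> \<open>The bound on \<open>card P\<close> says something only for finite
    \<open>P\<close>, as \<open>card\<close> is 0 on infinite sets.\<close>
  have "finite P" using finite_elements[OF simple_graphD(1)[OF G] P(1)] .
  then have one: "\<And>X Y. X \<in> P \<Longrightarrow> Y \<in> P \<Longrightarrow> X = Y" using P(2) card_le_Suc0_iff_eq by blast
  show "independent_set G (verts G)"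
    unfolding independent_set_def
  proof (intro ballI)
    fix u v assume uv: "u \<in> verts G" "v \<in> verts G"
    then obtain X Y where "X \<in> P" "Y \<in> P" "u \<in> X" "v \<in> Y"
      using partition_onD1[OF P(1)] by blast
    then show "\<not> adj G u v" using one P(3)[OF uv] by blast
  qed
next
  assume i: "independent_set G (verts G)"
  \<comment> \<open>Blocks of a partition are non-empty, so the empty graph must get no part at
    all.\<close>
  let ?P = "if verts G = {} then {} else {verts G}"
  have "complete_multipartite_parts G ?P"
    using i by (auto simp: complete_multipartite_parts_def partition_on_def independent_set_def)
  moreover have "enat (card ?P) \<le> 1" by (simp add: one_enat_def)
  ultimately show "\<exists>P. complete_multipartite_parts G P \<and> enat (card P) \<le> 1" by blast
qed

lemma independent_set_induced:
  "A \<subseteq> verts G \<Longrightarrow> A \<subseteq> S \<Longrightarrow> independent_set (induced G S) A \<longleftrightarrow> independent_set G A"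
  unfolding independent_set_def by (simp add: subset_iff cong: ball_cong)

lemma multipartite_on_induced:
  assumes "A \<subseteq> verts G" "A \<subseteq> S"
  shows "multipartite_on (induced G S) A \<longleftrightarrow> multipartite_on G A"
proof -
  have "adj (induced G S) u v \<longleftrightarrow> adj G u v" if "u \<in> A" "v \<in> A" for u v
    using that assms by auto
  then show ?thesis unfolding multipartite_on_def by (simp cong: ball_cong)
qed

lemma cluster_on_induced:
  assumes "A \<subseteq> verts G" "A \<subseteq> S"
  shows "cluster_on (induced G S) k A \<longleftrightarrow> cluster_on G k A"
proof -
  have "(\<forall>I\<subseteq>A. independent_set (induced G S) I \<longrightarrow> card I \<le> k) \<longleftrightarrow>
    (\<forall>I\<subseteq>A. independent_set G I \<longrightarrow> card I \<le> k)"
    using independent_set_induced assms by (metis subset_trans)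
  moreover have "adj (induced G S) u v \<longleftrightarrow> adj G u v" if "u \<in> A" "v \<in> A" for u v
    using that assms by auto
  ultimately show ?thesis
    unfolding cluster_on_def by (simp cong: ball_cong)
qed

lemma polar_partition_parts:
  assumes G: "simple_graph G" and B: "B \<subseteq> verts G"
  shows "cluster (induced G B) \<and> enat (card (components (induced G B))) \<le> enat k \<longleftrightarrow>
      cluster_on G k B"
    and "(\<exists>P. complete_multipartite_parts (induced G B) P) \<longleftrightarrow> multipartite_on G B"
    and "(\<exists>P. complete_multipartite_parts (induced G B) P \<and> enat (card P) \<le> 1) \<longleftrightarrow>
      independent_set G B"
proof -
  have B': "verts G \<inter> B = B" using B by blast
  note H = simple_graph_induced[OF G, of B]
  show "cluster (induced G B) \<and> enat (card (components (induced G B))) \<le> enat k \<longleftrightarrow>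
      cluster_on G k B"
    using cluster_iff_cluster_on[OF H, of k] cluster_on_induced[OF B] B' by simp
  show "(\<exists>P. complete_multipartite_parts (induced G B) P) \<longleftrightarrow> multipartite_on G B"
    using complete_multipartite_iff_multipartite_on[OF H] multipartite_on_induced[OF B] B' by simp
  show "(\<exists>P. complete_multipartite_parts (induced G B) P \<and> enat (card P) \<le> 1) \<longleftrightarrow>
      independent_set G B"
    using complete_1_partite_iff_independent[OF H] independent_set_induced[OF B] B' by simp
qed

text \<open>The cluster side is forced to be \<open>S - A\<close>, so \<open>A\<close> alone
  determines the partition. The bound \<open>s\<close> stays general, to be specialised to infinity
  and to 1.\<close>

lemma polar_induced_iff:
  assumes G: "simple_graph G" and S: "S \<subseteq> verts G"
  shows "polar s (enat k) (induced G S) \<longleftrightarrow> (\<exists>A\<subseteq>S.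
    (\<exists>P. complete_multipartite_parts (induced G A) P \<and> enat (card P) \<le> s) \<and>
    cluster_on G k (S - A))" (is "_ \<longleftrightarrow> (\<exists>A\<subseteq>S. ?M A \<and> _)")
proof -
  have "polar_partition s (enat k) (induced G S) A B \<longleftrightarrow>
    A \<subseteq> S \<and> B = S - A \<and> ?M A \<and> cluster_on G k (S - A)" for A B
  proof (cases "A \<subseteq> S \<and> B = S - A")
    case True
    then have "S \<inter> A = A" "S \<inter> B = S - A" "A \<union> B = verts G \<inter> S" "A \<inter> B = {}" "S - A \<subseteq> verts G"
      using S by blast+
    then show ?thesis
      using True polar_partition_parts(1)[OF G, of "S - A" k]
      by (simp add: polar_partition_def)
  next
    case False
    then have "\<not> (A \<union> B = verts G \<inter> S \<and> A \<inter> B = {})" using S by blast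
    then show ?thesis using False by (auto simp: polar_partition_def)
  qed
  then show ?thesis by (auto simp: polar_def)
qed

lemma polar_infinity_induced_iff:
  assumes G: "simple_graph G" and S: "S \<subseteq> verts G"
  shows "polar \<infinity> (enat k) (induced G S) \<longleftrightarrow> polar_on G k S"
proof -
  have "(\<exists>P. complete_multipartite_parts (induced G A) P \<and> enat (card P) \<le> \<infinity>) \<longleftrightarrow>
    multipartite_on G A" if "A \<subseteq> S" for A
    using polar_partition_parts(2)[OF G subset_trans[OF that S]] by simp
  then show ?thesis unfolding polar_induced_iff[OF assms] polar_on_def by auto
qed

lemma polar_1_induced_iff:
  assumes G: "simple_graph G" and S: "S \<subseteq> verts G"
  shows "polar 1 (enat k) (induced G S) \<longleftrightarrow> unipolar_on G k S"
proof -
  have "(\<exists>P. complete_multipartite_parts (induced G A) P \<and> enat (card P) \<le> 1) \<longleftrightarrow>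
    independent_set G A" if "A \<subseteq> S" for A
    using polar_partition_parts(3)[OF G subset_trans[OF that S]] .
  then show ?thesis unfolding polar_induced_iff[OF assms] unipolar_on_def by auto
qed

text \<open>Covers both the graph left after an edge is removed and, with \<open>S\<close> equal to
  \<open>verts G\<close>, the graph \<open>G\<close> itself.\<close>

lemma min_obstruction_induced_iff:
  assumes G: "simple_graph G" and S: "S \<subseteq> verts G"
  shows "cograph_min_polar_obstruction \<infinity> (enat k) (induced G S) \<longleftrightarrow>
    cograph (induced G S) \<and> min_obstruction_on G k S"
proof -
  have "polar \<infinity> (enat k) (induced (induced G S) T) \<longleftrightarrow> polar_on G k T" if "T \<subset> S" for T
  proof -
    have "S \<inter> T = T" "T \<subseteq> verts G" using that S by blast+
    then show ?thesis using polar_infinity_induced_iff[OF G] by simp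
  qed
  moreover have "verts G \<inter> S = S" using S by blast
  ultimately show ?thesis
    using polar_infinity_induced_iff[OF assms]
    by (auto simp: cograph_min_polar_obstruction_def min_obstruction_on_def)
qed


subsection \<open>Invariance under isomorphism\<close>

lemma graph_iso_sym:
  assumes "graph_iso G H"
  shows "graph_iso H G"
proof -
  obtain f where f: "bij_betw f (verts G) (verts H)"
    "\<And>u v. u \<in> verts G \<Longrightarrow> v \<in> verts G \<Longrightarrow> adj G u v \<longleftrightarrow> adj H (f u) (f v)"
    using assms by (auto simp: graph_iso_def)
  let ?g = "inv_into (verts G) f"
  have g: "?g u \<in> verts G" "f (?g u) = u" if "u \<in> verts H" for u
    using that f(1) by (auto simp: bij_betw_def intro: inv_into_into f_inv_into_f)
  have "adj H u v \<longleftrightarrow> adj G (?g u) (?g v)" if "u \<in> verts H" "v \<in> verts H" for u v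
    using f(2)[of "?g u" "?g v"] g that by simp
  then show ?thesis
    using bij_betw_inv_into[OF f(1)] unfolding graph_iso_def by blast
qed

lemma lessThan_4: "{..<4::nat} = {0, 1, 2, 3}"
  by auto

text \<open>A first-order form of the forbidden \<open>P_4\<close>. Distinctness of the four
  vertices is implied: adjacent ones differ as there are no loops, and each non-adjacent pair is
  told apart by a neighbour of only one of the two.\<close>

lemma cograph_iff:
  "cograph G \<longleftrightarrow> simple_graph G \<and> \<not> (\<exists>a b c d. adj G a b \<and> adj G b c \<and> adj G c d \<and>
     \<not> adj G a c \<and> \<not> adj G a d \<and> \<not> adj G b d)" (is "_ \<longleftrightarrow> _ \<and> \<not> ?P4")
proof (cases "simple_graph G")
  case G: True
  have "(\<exists>S\<subseteq>verts G. graph_iso (induced G S) (path_graph 4)) \<longleftrightarrow> ?P4"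
  proof
    assume "\<exists>S\<subseteq>verts G. graph_iso (induced G S) (path_graph 4)"
    then obtain S where S: "S \<subseteq> verts G" "graph_iso (path_graph 4) (induced G S)"
      using graph_iso_sym by blast
    then obtain f where f: "bij_betw f {..<4} (verts G \<inter> S)"
      "\<And>u v. u < 4 \<Longrightarrow> v < 4 \<Longrightarrow>
        adj (path_graph 4) u v \<longleftrightarrow> adj (induced G S) (f u) (f v)"
      by (auto simp: graph_iso_def path_graph_def)
    have "f u \<in> verts G \<inter> S" if "u < 4" for u using bij_betwE[OF f(1)] that by auto
    then have "adj G (f u) (f v) \<longleftrightarrow> v = Suc u \<or> u = Suc v" if "u < 4" "v < 4" for u v
      using f(2)[OF that] that by (simp add: path_graph_def)
    then have "adj G (f 0) (f 1) \<and> adj G (f 1) (f 2) \<and> adj G (f 2) (f 3) \<and>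
      \<not> adj G (f 0) (f 2) \<and> \<not> adj G (f 0) (f 3) \<and> \<not> adj G (f 1) (f 3)"
      by simp
    then show ?P4 by blast
  next
    assume ?P4
    then obtain a b c d where e: "adj G a b" "adj G b c" "adj G c d"
      and n: "\<not> adj G a c" "\<not> adj G a d" "\<not> adj G b d" by blast
    note irr = simple_graphD(5)[OF G] and sym = simple_graphD(4)[OF G]
    have e': "adj G b a" "adj G c b" "adj G d c" and n': "\<not> adj G c a" "\<not> adj G d a" "\<not> adj G d b"
      using e n sym by blast+
    have dist: "a \<noteq> b" "a \<noteq> c" "a \<noteq> d" "b \<noteq> c" "b \<noteq> d" "c \<noteq> d"
      using e n e' n' irr by auto
    let ?f = "\<lambda>i. [a, b, c, d] ! i"
    let ?S = "{a, b, c, d}"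
    have S: "?S \<subseteq> verts G" using e simple_graphD(2,3)[OF G] by blast
    have "bij_betw ?f {..<4} ?S"
      using dist unfolding bij_betw_def lessThan_4 by (auto simp: numeral_eq_Suc)
    moreover have "verts G \<inter> ?S = ?S" using S by blast
    moreover have "\<forall>u\<in>{..<4}. \<forall>v\<in>{..<4}.
        adj (path_graph 4) u v \<longleftrightarrow> adj (induced G ?S) (?f u) (?f v)"
      unfolding lessThan_4 using S e n e' n' irr
      by (simp add: path_graph_def numeral_eq_Suc)
    moreover have "verts (path_graph 4) = {..<4}" by (simp add: path_graph_def)
    ultimately have "graph_iso (path_graph 4) (induced G ?S)"
      unfolding graph_iso_def verts_induced by metis
    then show "\<exists>S\<subseteq>verts G. graph_iso (induced G S) (path_graph 4)"
      using S graph_iso_sym by blast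
  qed
  then show ?thesis by (simp add: cograph_def)
qed (simp add: cograph_def)

text \<open>The graph \<open>G'\<close> of the theorem is known only up to isomorphism. The lemmas
  here carry its properties over to an induced subgraph of \<open>G\<close>.\<close>

locale graph_isomorphism =
  fixes f :: "'a \<Rightarrow> 'b" and G :: "'a graph" and H :: "'b graph"
  assumes simple: "simple_graph G" "simple_graph H"
    and bij: "bij_betw f (verts G) (verts H)"
    and adj_iff: "u \<in> verts G \<Longrightarrow> v \<in> verts G \<Longrightarrow> adj H (f u) (f v) \<longleftrightarrow> adj G u v"
begin

lemma inj: "inj_on f (verts G)" and image: "f ` verts G = verts H"
  using bij by (auto simp: bij_betw_def)

lemma inj_subset: "S \<subseteq> verts G \<Longrightarrow> inj_on f S"
  using inj inj_on_subset by blast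

lemma independent_set_image:
  "I \<subseteq> verts G \<Longrightarrow> independent_set H (f ` I) \<longleftrightarrow> independent_set G I"
  unfolding independent_set_def by (simp add: adj_iff subset_iff)

lemma multipartite_on_image:
  assumes "A \<subseteq> verts G"
  shows "multipartite_on H (f ` A) \<longleftrightarrow> multipartite_on G A"
proof -
  have "adj H (f u) (f v) \<longleftrightarrow> adj G u v" if "u \<in> A" "v \<in> A" for u v
    using that assms adj_iff by blast
  then show ?thesis unfolding multipartite_on_def by simp
qed

lemma cluster_on_image:
  assumes B: "B \<subseteq> verts G"
  shows "cluster_on H k (f ` B) \<longleftrightarrow> cluster_on G k B"
proof -
  have "(\<forall>I\<subseteq>f ` B. independent_set H I \<longrightarrow> card I \<le> k) \<longleftrightarrow>
    (\<forall>I\<subseteq>B. independent_set H (f ` I) \<longrightarrow> card (f ` I) \<le> k)"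
    by (auto simp: subset_image_iff)
  also have "\<dots> \<longleftrightarrow> (\<forall>I\<subseteq>B. independent_set G I \<longrightarrow> card I \<le> k)"
    using independent_set_image card_image[OF inj_subset] B by (metis subset_trans)
  finally have "(\<forall>I\<subseteq>f ` B. independent_set H I \<longrightarrow> card I \<le> k) \<longleftrightarrow>
    (\<forall>I\<subseteq>B. independent_set G I \<longrightarrow> card I \<le> k)" .
  moreover have "adj H (f u) (f v) \<longleftrightarrow> adj G u v" "f u = f v \<longleftrightarrow> u = v" if "u \<in> B" "v \<in> B" for u v
    using that B adj_iff inj_on_eq_iff[OF inj] by blast+
  ultimately show ?thesis unfolding cluster_on_def by simp
qed

lemma polar_on_image:
  assumes S: "S \<subseteq> verts G"
  shows "polar_on H k (f ` S) \<longleftrightarrow> polar_on G k S"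
    and "unipolar_on H k (f ` S) \<longleftrightarrow> unipolar_on G k S"
proof -
  have "cluster_on H k (f ` S - f ` A) \<longleftrightarrow> cluster_on G k (S - A)"
    "multipartite_on H (f ` A) \<longleftrightarrow> multipartite_on G A"
    "independent_set H (f ` A) \<longleftrightarrow> independent_set G A" if "A \<subseteq> S" for A
  proof -
    have "f ` S - f ` A = f ` (S - A)"
      using inj_on_image_set_diff[OF inj, of S A] S that by blast
    then show "cluster_on H k (f ` S - f ` A) \<longleftrightarrow> cluster_on G k (S - A)"
      using cluster_on_image[of "S - A"] S by (metis Diff_subset subset_trans)
    show "multipartite_on H (f ` A) \<longleftrightarrow> multipartite_on G A"
      "independent_set H (f ` A) \<longleftrightarrow> independent_set G A"
      using multipartite_on_image independent_set_image that S by auto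
  qed
  then show "polar_on H k (f ` S) \<longleftrightarrow> polar_on G k S"
    "unipolar_on H k (f ` S) \<longleftrightarrow> unipolar_on G k S"
    unfolding polar_on_def unipolar_on_def by (auto simp: subset_image_iff)
qed

lemma min_obstruction_on_image:
  "min_obstruction_on H k (verts H) \<longleftrightarrow> min_obstruction_on G k (verts G)"
proof -
  have "(\<forall>T. T \<subset> verts H \<longrightarrow> polar_on H k T) \<longleftrightarrow> (\<forall>T. T \<subset> verts G \<longrightarrow> polar_on G k T)"
  proof (intro iffI allI impI)
    fix T assume a: "\<forall>T. T \<subset> verts H \<longrightarrow> polar_on H k T" and T: "T \<subset> verts G"
    then have "f ` T \<subset> verts H"
      using inj_on_image_eq_iff[OF inj, of T "verts G"] image by blast
    then show "polar_on G k T" using a polar_on_image(1)[of T k] T by blast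
  next
    fix T assume a: "\<forall>T. T \<subset> verts G \<longrightarrow> polar_on G k T" and T: "T \<subset> verts H"
    then obtain U where U: "U \<subseteq> verts G" "T = f ` U"
      using image by (metis psubset_imp_subset subset_image_iff)
    then have "U \<subset> verts G" using T image by blast
    then show "polar_on H k T" using a U polar_on_image(1)[of U k] by blast
  qed
  then show ?thesis
    using polar_on_image(1)[of "verts G" k] image by (simp add: min_obstruction_on_def)
qed

lemma cograph_image: "cograph H \<longleftrightarrow> cograph G"
proof -
  \<comment> \<open>Each of the four vertices is an end of an edge and hence in
    \<open>verts H\<close>; bounded quantifiers can then be moved along \<open>f\<close>.\<close>
  have "(\<exists>a b c d. adj H a b \<and> adj H b c \<and> adj H c d \<and>
      \<not> adj H a c \<and> \<not> adj H a d \<and> \<not> adj H b d) \<longleftrightarrow>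
    (\<exists>a\<in>verts H. \<exists>b\<in>verts H. \<exists>c\<in>verts H. \<exists>d\<in>verts H. adj H a b \<and> adj H b c \<and> adj H c d \<and>
      \<not> adj H a c \<and> \<not> adj H a d \<and> \<not> adj H b d)"
    using simple_graphD(2,3)[OF simple(2)] by meson
  also have "\<dots> \<longleftrightarrow>
    (\<exists>a\<in>verts G. \<exists>b\<in>verts G. \<exists>c\<in>verts G. \<exists>d\<in>verts G. adj G a b \<and> adj G b c \<and> adj G c d \<and>
      \<not> adj G a c \<and> \<not> adj G a d \<and> \<not> adj G b d)"
    unfolding image[symmetric] by (simp add: adj_iff cong: bex_cong)
  also have "\<dots> \<longleftrightarrow> (\<exists>a b c d. adj G a b \<and> adj G b c \<and> adj G c d \<and>
      \<not> adj G a c \<and> \<not> adj G a d \<and> \<not> adj G b d)"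
    using simple_graphD(2,3)[OF simple(1)] by meson
  finally show ?thesis using simple by (simp add: cograph_iff)
qed

lemma reachable_image:
  assumes "u \<in> verts G" "(adj G)\<^sup>*\<^sup>* u v"
  shows "(adj H)\<^sup>*\<^sup>* (f u) (f v)"
  using assms(2)
proof induction
  case (step v w)
  then have "adj H (f v) (f w)"
    using adj_iff simple_graphD(2,3)[OF simple(1)] by blast
  then show ?case using step by auto
qed simp

text \<open>A walk in \<open>H\<close> is lifted edge by edge; surjectivity of \<open>f\<close>
  provides a preimage of each next vertex.\<close>

lemma reachable_preimage:
  assumes "u \<in> verts G" "(adj H)\<^sup>*\<^sup>* (f u) w"
  shows "\<exists>v\<in>verts G. w = f v \<and> (adj G)\<^sup>*\<^sup>* u v"
  using assms(2)
proof induction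
  case base
  then show ?case using assms(1) by blast
next
  case (step w z)
  then obtain v where v: "v \<in> verts G" "w = f v" "(adj G)\<^sup>*\<^sup>* u v" by blast
  obtain t where t: "t \<in> verts G" "z = f t"
    using simple_graphD(3)[OF simple(2) step(2)] image by blast
  then have "adj G v t" using step(2) v adj_iff by blast
  then have "(adj G)\<^sup>*\<^sup>* u t" using v(3) by simp
  then show ?case using t by blast
qed

lemma component_of_image:
  assumes "u \<in> verts G"
  shows "component_of H (f u) = f ` component_of G u"
  using reachable_image[OF assms] reachable_preimage[OF assms] image
  unfolding component_of_def by blast

lemma components_image: "components H = (`) f ` components G"
  unfolding components_eq image[symmetric] by (simp add: image_image component_of_image)

end

text \<open>Without loops, any graph on one vertex is a \<open>K_1\<close>, so only the number of
  vertices matters.\<close>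

lemma trivial_components_eq:
  assumes "simple_graph G"
  shows "trivial_components G = {C \<in> components G. card C = 1}"
proof -
  have "graph_iso (induced G C) (complete_graph 1) \<longleftrightarrow> card C = 1" if "C \<in> components G" for C
  proof
    have C: "verts G \<inter> C = C" using that by (auto simp: components_eq component_of_def)
    {
      assume "graph_iso (induced G C) (complete_graph 1)"
      then obtain f where "bij_betw f C {..<1::nat}"
        using C by (auto simp: graph_iso_def complete_graph_def)
      then show "card C = 1" using bij_betw_same_card by fastforce
    next
      assume "card C = 1"
      then obtain x where x: "C = {x}" by (auto simp: card_1_singleton_iff)
      have "bij_betw (\<lambda>_. 0) {x} {..<1::nat}" by (auto simp: bij_betw_def)
      then show "graph_iso (induced G C) (complete_graph 1)"
        using C x simple_graphD(5)[OF assms]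
        unfolding graph_iso_def by (intro exI[of _ "\<lambda>_. 0"]) (auto simp: complete_graph_def)
    }
  qed
  then show ?thesis by (auto simp: trivial_components_def)
qed

context graph_isomorphism
begin

text \<open>Taking images under \<open>f\<close> is injective on subsets of \<open>verts G\<close>
  and preserves their size.\<close>

lemma has_type_image: "has_type H c i \<longleftrightarrow> has_type G c i"
proof -
  have sub: "C \<subseteq> verts G" if "C \<in> components G" for C
    using that by (auto simp: components_eq component_of_def)
  have inj': "inj_on ((`) f) (components G)"
    using inj_on_subset[OF inj_on_image_Pow[OF inj]] sub by blast
  have "trivial_components H = (`) f ` trivial_components G"
    unfolding trivial_components_eq[OF simple(1)] trivial_components_eq[OF simple(2)] components_image
    using card_image[OF inj_subset[OF sub]] by auto
  moreover have "inj_on ((`) f) (trivial_components G)"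
    using inj_on_subset[OF inj'] by (auto simp: trivial_components_def)
  ultimately show ?thesis
    using card_image[OF inj'] by (simp add: has_type_def components_image card_image)
qed

lemma polar_1_image: "polar 1 (enat k) H \<longleftrightarrow> polar 1 (enat k) G"
  using polar_1_induced_iff[OF simple(1) order_refl, of k] polar_1_induced_iff[OF simple(2) order_refl, of k]
    polar_on_image(2)[of "verts G" k] image
  by (simp add: induced_verts[OF simple(1)] induced_verts[OF simple(2)])

lemma cograph_min_polar_obstruction_image:
  "cograph_min_polar_obstruction \<infinity> (enat k) H \<longleftrightarrow> cograph_min_polar_obstruction \<infinity> (enat k) G"
  using min_obstruction_induced_iff[OF simple(1) order_refl, of k]
    min_obstruction_induced_iff[OF simple(2) order_refl, of k] min_obstruction_on_image cograph_image
  by (simp add: induced_verts[OF simple(1)] induced_verts[OF simple(2)])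

end


subsection \<open>Splitting off an isolated edge\<close>

lemma component_of_subset_closed:
  assumes "adj_closed G K" "u \<in> K"
  shows "component_of G u \<subseteq> K"
proof -
  have "v \<in> K" if "(adj G)\<^sup>*\<^sup>* u v" for v
    using that by induction (auto intro: assms adj_closedD[OF assms(1)])
  then show ?thesis by (auto simp: component_of_def)
qed

lemma adj_closed_component:
  assumes G: "simple_graph G" and C: "C \<in> components G"
  shows "adj_closed G C"
  using C simple_graphD(3)[OF G]
  by (auto simp: adj_closed_def components_eq component_of_def intro: rtranclp.rtrancl_into_rtrancl)

text \<open>A walk that starts in the closed set \<open>W\<close> never leaves it.\<close>

lemma component_of_induced_closed:
  assumes W: "adj_closed G W" "W \<subseteq> verts G" "u \<in> W"
  shows "component_of (induced G W) u = component_of G u"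
proof -
  have "v \<in> W \<and> (adj (induced G W))\<^sup>*\<^sup>* u v" if "(adj G)\<^sup>*\<^sup>* u v" for v
    using that
  proof induction
    case (step v w)
    then have "w \<in> W" using adj_closedD[OF W(1)] by blast
    then have "adj (induced G W) v w" using step W(2) by auto
    then show ?case using step \<open>w \<in> W\<close> rtranclp.rtrancl_into_rtrancl[of "adj (induced G W)"] by blast
  qed (simp add: W(3))
  moreover have "(adj G)\<^sup>*\<^sup>* u v" if "(adj (induced G W))\<^sup>*\<^sup>* u v" for v
    using that by (rule rtranclp_mono[THEN predicate2D, rotated]) (rule predicate2I, simp)
  ultimately show ?thesis using W(2) unfolding component_of_def verts_induced by blast
qed

lemma components_disjoint:
  assumes G: "simple_graph G" and C: "C \<in> components G" "D \<in> components G" "v \<in> C" "v \<in> D"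
  shows "C = D"
proof -
  have "C = component_of G v" if C: "C \<in> components G" "v \<in> C" for C
  proof -
    obtain u where u: "u \<in> verts G" "C = component_of G u"
      using C(1) unfolding components_eq by blast
    then have "v \<in> verts G" "(adj G)\<^sup>*\<^sup>* u v" using C(2) by (auto simp: component_of_def)
    then show ?thesis using component_of_eq_iff[OF G u(1)] u(2) by blast
  qed
  then show ?thesis using C by metis
qed

context
  fixes G :: "'a graph" and x y :: 'a and W :: "'a set"
  assumes G: "simple_graph G" and e: "isolated_edge G x y"
  defines "W \<equiv> verts G - {x, y}"
begin

lemma adj_closed_remove_edge: "adj_closed G W"
  using simple_graphD(3)[OF G] isolated_edgeD[OF G e] by (auto simp: adj_closed_def W_def)

lemma components_add_edge:
  "components G = insert {x, y} (components (induced G W))" "{x, y} \<notin> components (induced G W)"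
proof -
  note E = isolated_edgeD[OF G e]
  have W: "W \<subseteq> verts G" "verts G \<inter> W = W" "verts G = insert x (insert y W)"
    using E by (auto simp: W_def)
  have K: "adj_closed G {x, y}" using e by (simp add: isolated_edge_def)
  have yx: "adj G y x" using E by blast
  have "component_of G x = {x, y}"
    using component_of_subset_closed[OF K, of x] E(2-4) by (auto simp: component_of_def)
  moreover have "component_of G y = {x, y}"
    using component_of_subset_closed[OF K, of y] yx E(3,4) by (auto simp: component_of_def)
  moreover have "components (induced G W) = component_of G ` W"
    unfolding components_eq verts_induced W(2)
    using component_of_induced_closed[OF adj_closed_remove_edge W(1)] by (intro image_cong) auto
  ultimately show "components G = insert {x, y} (components (induced G W))"
    using W(3) by (simp add: components_eq)
  show "{x, y} \<notin> components (induced G W)"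
    by (auto simp: components_eq component_of_def W_def)
qed

text \<open>The additional component \<open>{x, y}\<close> has two vertices, so the count of trivial
  components is unaffected.\<close>

lemma has_type_add_edge: "has_type G (Suc c) i \<longleftrightarrow> has_type (induced G W) c i"
proof -
  have "finite (components (induced G W))"
    using simple_graphD(1)[OF simple_graph_induced[OF G]] unfolding components_eq by blast
  then have "card (components G) = Suc (card (components (induced G W)))"
    using components_add_edge by simp
  moreover have "trivial_components G = trivial_components (induced G W)"
    unfolding trivial_components_eq[OF G] trivial_components_eq[OF simple_graph_induced[OF G]]
    using components_add_edge(1) isolated_edgeD(1)[OF G e] by auto
  ultimately show ?thesis by (simp add: has_type_def)
qed

text \<open>A \<open>P_4\<close> is connected and too large to fit into the isolated edge, so it
  lies in \<open>W\<close>.\<close>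

lemma cograph_add_edge: "cograph G \<longleftrightarrow> cograph (induced G W)"
proof -
  note E = isolated_edgeD[OF G e]
  have "a \<in> W \<and> b \<in> W \<and> c \<in> W \<and> d \<in> W"
    if P: "adj G a b" "adj G b c" "adj G c d" "\<not> adj G a d" for a b c d
  proof -
    \<comment> \<open>If \<open>a\<close> were an end of the isolated edge, then \<open>b\<close>
      would be the other end and \<open>c\<close> would be \<open>a\<close> again; but
      \<open>d\<close> is adjacent to \<open>c\<close> and not to \<open>a\<close>.\<close>
    have "a \<noteq> c" using P by blast
    then have "a \<notin> {x, y}" using P(1,2) E by auto
    then have "a \<in> W" using simple_graphD(2)[OF G P(1)] by (simp add: W_def)
    then show ?thesis using P adj_closedD[OF adj_closed_remove_edge] by blast
  qed
  then have "(\<exists>a b c d. adj G a b \<and> adj G b c \<and> adj G c d \<and>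
      \<not> adj G a c \<and> \<not> adj G a d \<and> \<not> adj G b d) \<longleftrightarrow>
    (\<exists>a b c d. adj (induced G W) a b \<and> adj (induced G W) b c \<and> adj (induced G W) c d \<and>
      \<not> adj (induced G W) a c \<and> \<not> adj (induced G W) a d \<and> \<not> adj (induced G W) b d)"
    unfolding adj_induced W_def by blast
  then show ?thesis
    unfolding cograph_iff using G simple_graph_induced[OF G] by simp
qed

text \<open>The equivalence of the theorem, apart from the type, once an isolated edge has been
  located.\<close>

lemma cograph_min_polar_obstruction_add_edge:
  "cograph_min_polar_obstruction \<infinity> (enat (Suc k)) G \<longleftrightarrow>
    cograph_min_polar_obstruction \<infinity> (enat k) (induced G W) \<and> polar 1 (enat (Suc k)) (induced G W)"
proof -
  have W: "W \<subseteq> verts G" by (auto simp: W_def)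
  have "cograph_min_polar_obstruction \<infinity> (enat (Suc k)) G \<longleftrightarrow>
      cograph G \<and> min_obstruction_on G (Suc k) (verts G)"
    using min_obstruction_induced_iff[OF G order_refl] by (simp add: induced_verts[OF G])
  then show ?thesis
    using min_obstruction_add_edge[OF G e, folded W_def] cograph_add_edge
      min_obstruction_induced_iff[OF G W] polar_1_induced_iff[OF G W] by simp
qed

lemma graph_iso_add_edge: "graph_iso G (disjoint_union (complete_graph 2) (induced G W))"
proof -
  note E = isolated_edgeD[OF G e]
  let ?H = "disjoint_union (complete_graph 2) (induced G W)"
  let ?f = "\<lambda>v. if v = x then Inl 0 else if v = y then Inl (1::nat) else Inr v"
  have "verts ?H = insert (Inl 0) (insert (Inl 1) (Inr ` W))"
    by (auto simp: disjoint_union_def complete_graph_def W_def)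
  moreover have "verts G = insert x (insert y W)" "x \<notin> W" "y \<notin> W" using E by (auto simp: W_def)
  ultimately have "bij_betw ?f (verts G) (verts ?H)"
    using E(1) by (auto simp: bij_betw_def inj_on_def image_iff)
  moreover have "adj G u v \<longleftrightarrow> adj ?H (?f u) (?f v)" if "u \<in> verts G" "v \<in> verts G" for u v
    using that E simple_graphD(5)[OF G]
    by (auto simp: disjoint_union_def complete_graph_def W_def)
  ultimately show ?thesis unfolding graph_iso_def by blast
qed

end

section \<open>Locating the isolated edge\<close>

text \<open>The two \<open>Inl\<close> vertices are mapped to the ends of the edge, and the
  restriction to the \<open>Inr\<close> vertices is the isomorphism \<open>h\<close>.\<close>

lemma isolated_edge_of_graph_iso:
  fixes G :: "'a graph" and G' :: "'b graph"
  assumes G: "simple_graph G" and G': "simple_graph G'"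
    and iso: "graph_iso G (disjoint_union (complete_graph 2) G')"
  obtains x y h where "isolated_edge G x y" "graph_isomorphism h G' (induced G (verts G - {x, y}))"
proof -
  let ?H = "disjoint_union (complete_graph 2) G'"
  obtain g where g: "bij_betw g (verts ?H) (verts G)"
    "\<And>u v. u \<in> verts ?H \<Longrightarrow> v \<in> verts ?H \<Longrightarrow> adj ?H u v \<longleftrightarrow> adj G (g u) (g v)"
    using graph_iso_sym[OF iso] by (auto simp: graph_iso_def)
  define x y where "x = g (Inl 0)" and "y = g (Inl 1)"
  have H: "verts ?H = insert (Inl 0) (insert (Inl 1) (Inr ` verts G'))"
    by (auto simp: disjoint_union_def complete_graph_def)
  have inj: "inj_on g (verts ?H)" and im: "g ` verts ?H = verts G"
    using g(1) by (auto simp: bij_betw_def)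
  have adj: "adj ?H (Inl 0) v \<longleftrightarrow> v = Inl 1" "adj ?H (Inl 1) v \<longleftrightarrow> v = Inl 0" for v
    by (auto simp: disjoint_union_def complete_graph_def split: sum.splits)
  have "x \<noteq> y" using inj_onD[OF inj, of "Inl 0" "Inl 1"] by (auto simp: x_def y_def H)
  moreover have nb: "adj G x v \<longleftrightarrow> v = y" "adj G y v \<longleftrightarrow> v = x" for v
  proof -
    show "adj G x v \<longleftrightarrow> v = y"
    proof
      assume a: "adj G x v"
      then obtain w where "w \<in> verts ?H" "v = g w" using simple_graphD(3)[OF G] im by blast
      then show "v = y" using a g(2)[of "Inl 0" w] adj by (simp add: x_def y_def H)
    next
      assume "v = y"
      then show "adj G x v" using g(2)[of "Inl 0" "Inl 1"] adj by (simp add: x_def y_def H)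
    qed
    show "adj G y v \<longleftrightarrow> v = x"
    proof
      assume a: "adj G y v"
      then obtain w where "w \<in> verts ?H" "v = g w" using simple_graphD(3)[OF G] im by blast
      then show "v = x" using a g(2)[of "Inl 1" w] adj by (simp add: x_def y_def H)
    next
      assume "v = x"
      then show "adj G y v" using g(2)[of "Inl 1" "Inl 0"] adj by (simp add: x_def y_def H)
    qed
  qed
  ultimately have e: "isolated_edge G x y"
    by (auto simp: isolated_edge_def clique_def adj_closed_def)
  let ?W = "verts G - {x, y}"
  have "inj_on (g \<circ> Inr) (verts G')"
    by (rule comp_inj_on) (auto intro: inj_on_subset[OF inj] simp: H)
  moreover have "(g \<circ> Inr) ` verts G' = ?W"
  proof -
    have "g ` (verts ?H - {Inl 0, Inl 1}) = g ` verts ?H - g ` {Inl 0, Inl 1}"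
      by (rule inj_on_image_set_diff[OF inj]) (auto simp: H)
    moreover have "verts ?H - {Inl 0, Inl 1} = Inr ` verts G'" by (auto simp: H)
    ultimately show ?thesis using im by (simp add: x_def y_def image_comp)
  qed
  ultimately have "bij_betw (g \<circ> Inr) (verts G') ?W" by (simp add: bij_betw_def)
  moreover from this have "adj (induced G ?W) ((g \<circ> Inr) u) ((g \<circ> Inr) v) \<longleftrightarrow> adj G' u v"
    if "u \<in> verts G'" "v \<in> verts G'" for u v
    using that g(2)[of "Inr u" "Inr v"] bij_betwE by (fastforce simp: H disjoint_union_def)
  moreover have "verts G \<inter> ?W = ?W" by blast
  ultimately have "graph_isomorphism (g \<circ> Inr) G' (induced G ?W)"
    using G' simple_graph_induced[OF G] unfolding graph_isomorphism_def by simp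
  then show ?thesis using that e by blast
qed

text \<open>The type provides an isolated vertex and two nontrivial components. One of these is a
  cluster; being connected it is a clique, and minimality leaves it exactly two vertices.\<close>

lemma isolated_edge_exists:
  assumes G: "simple_graph G" and m: "min_obstruction_on G k (verts G)"
    and t: "has_type G c p" "1 \<le> p" "p + 2 \<le> c"
  obtains x y where "isolated_edge G x y"
proof -
  let ?T = "trivial_components G"
  have fin: "finite (components G)" using simple_graphD(1)[OF G] by (simp add: components_eq)
  have sub: "?T \<subseteq> components G" by (auto simp: trivial_components_def)
  have "?T \<noteq> {}" using t(1,2) by (auto simp: has_type_def)
  then obtain v where v: "{v} \<in> components G"
    using trivial_components_eq[OF G] by (auto simp: card_1_singleton_iff)
  have "card (components G - ?T) \<ge> 2"
    using t card_Diff_subset[OF finite_subset[OF sub fin] sub] by (simp add: has_type_def)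
  then obtain K L where KL: "K \<in> components G" "L \<in> components G" "K \<notin> ?T" "L \<notin> ?T" "K \<noteq> L"
    by (auto simp: card_le_Suc_iff numeral_2_eq_2)
  have comp: "C \<subseteq> verts G" "C \<noteq> {}" "adj_closed G C" if "C \<in> components G" for C
    using that adj_closed_component[OF G] by (auto simp: components_eq component_of_def)
  have "{v} \<in> ?T" using v trivial_components_eq[OF G] by simp
  then have "v \<notin> K" "v \<notin> L"
    using components_disjoint[OF G v, of K v] components_disjoint[OF G v, of L v] KL by auto
  moreover have "K \<inter> L = {}" using components_disjoint[OF G KL(1,2)] KL(5) by blast
  ultimately have "cluster_on G k K \<or> cluster_on G k L"
    using comp(1)[OF v]
    by (intro min_obstruction_isolated_vertex_cluster[OF G m, of v] comp KL v) simp_all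
  then obtain C where C: "C \<in> components G" "C \<notin> ?T" "cluster_on G k C" using KL by blast
  \<comment> \<open>Within the closed cluster \<open>C\<close>, reachability collapses to adjacency
    or equality.\<close>
  have reach: "v \<in> C \<and> (u = v \<or> adj G u v)" if "u \<in> C" "(adj G)\<^sup>*\<^sup>* u v" for u v
    using that(2)
  proof induction
    case (step v w)
    then have "w \<in> C" using adj_closedD[OF comp(3)[OF C(1)]] by blast
    then show ?case using step that(1) C(3) unfolding cluster_on_def by blast
  qed (simp add: that(1))
  have cl: "clique G C"
    unfolding clique_def
  proof (intro ballI impI)
    fix u v assume uv: "u \<in> C" "v \<in> C" "u \<noteq> v"
    then have "u \<in> verts G" using comp(1)[OF C(1)] by blast
    then have "component_of G u \<in> components G" "u \<in> component_of G u"
      by (auto simp: components_eq component_of_def)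
    then have "component_of G u = C" using components_disjoint[OF G] C(1) uv(1) by blast
    then have "(adj G)\<^sup>*\<^sup>* u v" using uv(2) by (auto simp: component_of_def)
    then show "adj G u v" using reach[OF uv(1)] uv(3) by blast
  qed
  have "card C \<le> 2"
    by (rule min_obstruction_clique_component_le_2[OF G m comp(1)[OF C(1)] cl comp(3)[OF C(1)]])
  moreover have "card C \<noteq> 1" using C trivial_components_eq[OF G] by auto
  moreover have "card C \<noteq> 0"
    using comp(1,2)[OF C(1)] simple_graphD(1)[OF G] by (auto dest: finite_subset)
  ultimately have "card C = 2" by linarith
  then obtain x y where "C = {x, y}" "x \<noteq> y" by (meson card_2_iff)
  then have "isolated_edge G x y" using cl comp(3)[OF C(1)] by (simp add: isolated_edge_def)
  then show ?thesis using that by blast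
qed

text \<open>Simplicity of \<open>G\<close> is assumed because \<open>graph_iso\<close> compares
  adjacency only on vertices, so the right-hand side does not exclude adjacencies outside
  \<open>verts G\<close>.\<close>

theorem theorem9:
  fixes j k p :: nat and G :: "'a graph"
  assumes "1 \<le> p" and "p \<le> k - j"
    and "simple_graph G"
  shows "cograph_min_polar_obstruction \<infinity> (enat k) G \<and> has_type G (k - j + 2) p \<longleftrightarrow>
    (\<exists>G' :: 'a graph.
       graph_iso G (disjoint_union (complete_graph 2) G') \<and>
       cograph_min_polar_obstruction \<infinity> (enat (k - 1)) G' \<and>
       has_type G' (k - j + 1) p \<and>
       polar 1 (enat k) G')"
    (is "?L \<longleftrightarrow> ?R")
proof -
  note G = assms(3)
  \<comment> \<open>The bounds on \<open>p\<close> force \<open>j < k\<close>; hence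
    \<open>k\<close> is positive, and neither \<open>k - j\<close> nor \<open>k - 1\<close> is
    truncated.\<close>
  obtain n where k: "k = Suc n" using assms(1,2) by (cases k) auto
  show ?thesis
  proof
    assume L: ?L
    then have "min_obstruction_on G k (verts G)"
      using min_obstruction_induced_iff[OF G order_refl] by (simp add: induced_verts[OF G])
    then obtain x y where e: "isolated_edge G x y"
      \<comment> \<open>The bound \<open>p \<le> k - j\<close> says that at least two of the
        \<open>k - j + 2\<close> components are nontrivial.\<close>
      using isolated_edge_exists[OF G, of k "k - j + 2" p] L assms(1,2) by auto
    let ?G' = "induced G (verts G - {x, y})"
    have "cograph_min_polar_obstruction \<infinity> (enat n) ?G'" "polar 1 (enat k) ?G'"
      using L cograph_min_polar_obstruction_add_edge[OF G e] by (simp_all add: k)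
    moreover have "has_type ?G' (k - j + 1) p"
      using L has_type_add_edge[OF G e] by simp
    ultimately show ?R
      using graph_iso_add_edge[OF G e] k by (intro exI[of _ ?G']) simp
  next
    assume ?R
    then obtain G' :: "'a graph" where iso: "graph_iso G (disjoint_union (complete_graph 2) G')"
      and G': "cograph_min_polar_obstruction \<infinity> (enat n) G'" "has_type G' (k - j + 1) p"
        "polar 1 (enat k) G'"
      by (auto simp: k)
    have "simple_graph G'" using G'(1) by (simp add: cograph_min_polar_obstruction_def cograph_def)
    then obtain x y h where e: "isolated_edge G x y"
      and h: "graph_isomorphism h G' (induced G (verts G - {x, y}))"
      using isolated_edge_of_graph_iso[OF G _ iso] by blast
    \<comment> \<open>The properties of \<open>G'\<close> pass along \<open>h\<close> to the induced
      subgraph, to which the isolated edge is then added back.\<close>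
    show ?L
      using G' cograph_min_polar_obstruction_add_edge[OF G e, of n]
        has_type_add_edge[OF G e, of "k - j + 1" p]
        graph_isomorphism.cograph_min_polar_obstruction_image[OF h]
        graph_isomorphism.has_type_image[OF h] graph_isomorphism.polar_1_image[OF h]
      by (simp add: k)
  qed
qed

end
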